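(* For every integer $n\geq 3$, the Sigma index of the caterpillar tree $C(n,3)$ is $$\sigma(C(n,3)) = 48(n-2)+56.$$
   Context: All graphs are finite, simple and undirected. For a graph $G$ with edge set $E(G)$, $d_G(v)$ denotes the degree of the vertex $v$. The Sigma index of $G$ is $\sigma(G)=\sum_{uv\in E(G)}(d_G(u)-d_G(v))^2$. For positive integers $n,m$, the caterpillar tree $C(n,m)$ is the tree consisting of a path $x_1x_2\cdots x_n$ on $n$ vertices (the main vertices) together with, for each $i=1,\dots,n$, exactly $m$ pendent vertices (leaves) adjacent to $x_i$, these leaves being distinct for distinct $i$. In particular, in $C(n,3)$ each of the $n$ path vertices has exactly three pendent vertices attached. *)

theory Defs
  imports Main
begin

record 'a graph =
  verts :: "'a set"
  edges :: "'a set set"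

definition finite_simple_graph :: "'a graph \<Rightarrow> bool" where
  "finite_simple_graph G \<longleftrightarrow>
     finite (verts G) \<and> (\<forall>e \<in> edges G. e \<subseteq> verts G \<and> card e = 2)"

definition degree :: "'a graph \<Rightarrow> 'a \<Rightarrow> nat" where
  "degree G v = card {e \<in> edges G. v \<in> e}"

text \<open>
  The term \<open>(d(u) - d(v))\<^sup>2\<close> of the Sigma index for the edge \<open>e = {u, v}\<close>. It is symmetric
  in \<open>u\<close> and \<open>v\<close>, so the description is unique (see \<open>sigma_term_edge\<close> below). The
  difference is taken in the integers, as subtraction on \<open>nat\<close> truncates.
\<close>

definition sigma_term :: "'a graph \<Rightarrow> 'a set \<Rightarrow> int" where
  "sigma_term G e =
     (THE k. \<exists>u v. e = {u, v} \<and> k = (int (degree G u) - int (degree G v))\<^sup>2)"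

lemma sigma_term_edge:
  "sigma_term G {u, v} = (int (degree G u) - int (degree G v))\<^sup>2"
  unfolding sigma_term_def
  by (rule the_equality) (auto simp: doubleton_eq_iff power2_commute)

definition sigma_index :: "'a graph \<Rightarrow> int" where
  "sigma_index G = (\<Sum>e \<in> edges G. sigma_term G e)"

text \<open>
  In the caterpillar \<open>C(n, m)\<close>, \<open>Main i\<close> is the path vertex \<open>x\<^sub>i\<close>, and \<open>Leaf i j\<close> is the
  \<open>j\<close>-th pendent vertex at \<open>x\<^sub>i\<close>.
\<close>

datatype cvertex = Main nat | Leaf nat nat

definition caterpillar :: "nat \<Rightarrow> nat \<Rightarrow> cvertex graph" where
  "caterpillar n m =
     \<lparr> verts = {Main i | i. i \<in> {1..n}} \<union> {Leaf i j | i j. i \<in> {1..n} \<and> j \<in> {1..m}},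
       edges = {{Main i, Main (i + 1)} | i. i \<in> {1..<n}}
             \<union> {{Main i, Leaf i j} | i j. i \<in> {1..n} \<and> j \<in> {1..m}} \<rparr>"

lemma finite_simple_graph_caterpillar: "finite_simple_graph (caterpillar n m)"
proof -
  have "{Leaf i j | i j. i \<in> {1..n} \<and> j \<in> {1..m}} = (\<lambda>(i, j). Leaf i j) ` ({1..n} \<times> {1..m})"
    by auto
  then have "finite {Leaf i j | i j. i \<in> {1..n} \<and> j \<in> {1..m}}"
    by simp
  then show ?thesis
    unfolding finite_simple_graph_def caterpillar_def by auto
qed

end

theory Submission imports Defs begin

text \<open>
  The two end vertices of the path have degree \<open>m + 1\<close>, the inner ones \<open>m + 2\<close>, and leaves have
  degree \<open>1\<close>. So only the first and the last path edge contribute, \<open>1\<close> each; a pendent edge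
  contributes \<open>m\<^sup>2\<close> at an end vertex and \<open>(m + 1)\<^sup>2\<close> at an inner one.
\<close>

text \<open>Written as images of index sets, the edges can be counted and summed over their indices,
  by injectivity.\<close>

lemma edges_caterpillar:
  "edges (caterpillar n m) =
     (\<lambda>i. {Main i, Main (i + 1)}) ` {1..<n} \<union> (\<lambda>(i, j). {Main i, Leaf i j}) ` ({1..n} \<times> {1..m})"
  unfolding caterpillar_def by auto

lemma degree_Leaf:
  assumes "i \<in> {1..n}" "j \<in> {1..m}"
  shows "degree (caterpillar n m) (Leaf i j) = 1"
proof -
  have "{e \<in> edges (caterpillar n m). Leaf i j \<in> e} = {{Main i, Leaf i j}}"
    using assms unfolding edges_caterpillar by auto
  then show ?thesis
    by (simp add: degree_def)
qed

text \<open>Besides its \<open>m\<close> leaves, \<open>Main i\<close> has a right neighbour unless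
  \<open>i = n\<close> and a left one unless \<open>i = 1\<close>; for \<open>n = 1\<close> it has
  neither.\<close>

lemma degree_Main:
  assumes "i \<in> {1..n}"
  shows "degree (caterpillar n m) (Main i) = m + (if i < n then 1 else 0) + (if 1 < i then 1 else 0)"
proof -
  let ?R = "if i < n then {{Main i, Main (i + 1)}} else {}"
  let ?L = "if 1 < i then {{Main (i - 1), Main i}} else {}"
  let ?P = "(\<lambda>j. {Main i, Leaf i j}) ` {1..m}"
  \<comment> \<open>The edge to the left neighbour is indexed by its own left end,
    \<open>i - 1\<close>.\<close>
  have "{Main (i - 1), Main i} \<in> (\<lambda>i. {Main i, Main (i + 1)}) ` {1..<n}" if "1 < i"
    using assms that by (intro image_eqI[of _ _ "i - 1"]) auto
  then have "{e \<in> edges (caterpillar n m). Main i \<in> e} = ?P \<union> ?R \<union> ?L"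
    using assms unfolding edges_caterpillar by (auto split: if_splits)
  moreover have "card ?P = m"
    by (subst card_image) (auto simp: inj_on_def doubleton_eq_iff)
  moreover have "card (?P \<union> ?R) = card ?P + card ?R"
    by (rule card_Un_disjoint) (auto simp: doubleton_eq_iff)
  moreover have "card (?P \<union> ?R \<union> ?L) = card (?P \<union> ?R) + card ?L"
    by (rule card_Un_disjoint) (auto simp: doubleton_eq_iff split: if_splits)
  ultimately show ?thesis
    by (simp add: degree_def)
qed

text \<open>Path edges and pendent edges are summed separately. The \<open>m\<close> pendent edges
  at \<open>Main i\<close> have equal terms, since each leaf has degree 1.\<close>

lemma sigma_index_caterpillar_sum:
  fixes n m :: nat
  defines "d \<equiv> \<lambda>i. int (degree (caterpillar n m) (Main i))"
  shows "sigma_index (caterpillar n m) =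
    (\<Sum>i = 1..<n. (d i - d (i + 1))\<^sup>2) + (\<Sum>i = 1..n. int m * (d i - 1)\<^sup>2)"
proof -
  let ?G = "caterpillar n m"
  let ?f = "\<lambda>i. {Main i, Main (i + 1)}" and ?g = "\<lambda>(i, j). {Main i, Leaf i j}"
  have f: "inj_on ?f {1..<n}" and g: "inj_on ?g ({1..n} \<times> {1..m})"
    by (auto simp: inj_on_def doubleton_eq_iff)
  have "sigma_index ?G = sum (sigma_term ?G) (?f ` {1..<n}) + sum (sigma_term ?G) (?g ` ({1..n} \<times> {1..m}))"
    unfolding sigma_index_def edges_caterpillar
    by (rule sum.union_disjoint) (auto simp: doubleton_eq_iff)
  also have "sum (sigma_term ?G) (?f ` {1..<n}) = (\<Sum>i = 1..<n. (d i - d (i + 1))\<^sup>2)"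
    unfolding sum.reindex[OF f] by (simp add: sigma_term_edge d_def)
  also have "sum (sigma_term ?G) (?g ` ({1..n} \<times> {1..m})) = (\<Sum>(i, j) \<in> {1..n} \<times> {1..m}. (d i - 1)\<^sup>2)"
    unfolding sum.reindex[OF g]
    by (rule sum.cong) (auto simp: sigma_term_edge d_def degree_Leaf)
  also have "\<dots> = (\<Sum>i = 1..n. int m * (d i - 1)\<^sup>2)"
    by (simp flip: sum.cartesian_product)
  finally show ?thesis .
qed

text \<open>The pendent edges give the first two summands, from the \<open>n - 2\<close> inner
  vertices and the two ends; the path gives the final 2.\<close>

lemma sigma_index_caterpillar:
  fixes n m :: nat
  assumes "n \<ge> 3"
  shows "sigma_index (caterpillar n m) = (int n - 2) * int m * (int m + 1)\<^sup>2 + 2 * int m ^ 3 + 2"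
proof -
  define d where "d i = int (degree (caterpillar n m) (Main i))" for i
  have ends: "d 1 = int m + 1" "d n = int m + 1"
    using assms by (auto simp: d_def degree_Main)
  have inner: "d i = int m + 2" if "1 < i" "i < n" for i
    using that by (auto simp: d_def degree_Main)
  \<comment> \<open>The first and the last path edge are singled out; they are distinct because
    \<open>n \<ge> 3\<close>.\<close>
  have path: "{1..<n} = insert 1 (insert (n - 1) {2..<n - 1})"
    and main: "{1..n} = insert 1 (insert n {2..<n})"
    using assms by auto
  \<comment> \<open>Here \<open>i + 1 < n\<close>, so both ends of the edge are inner
    vertices.\<close>
  have "(\<Sum>i = 2..<n - 1. (d i - d (i + 1))\<^sup>2) = 0"
    by (intro sum.neutral) (auto simp: inner)
  then have "(\<Sum>i = 1..<n. (d i - d (i + 1))\<^sup>2) = 2"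
    unfolding path using assms ends inner[of 2] inner[of "n - 1"] by (simp add: numeral_2_eq_2)
  moreover have "(\<Sum>i = 2..<n. int m * (d i - 1)\<^sup>2) = (\<Sum>i = 2..<n. int m * (int m + 1)\<^sup>2)"
    by (intro sum.cong) (auto simp: inner)
  then have "(\<Sum>i = 1..n. int m * (d i - 1)\<^sup>2) = 2 * int m ^ 3 + (int n - 2) * (int m * (int m + 1)\<^sup>2)"
    unfolding main using assms ends by (simp add: power2_eq_square power3_eq_cube of_nat_diff)
  ultimately show ?thesis
    unfolding sigma_index_caterpillar_sum d_def by simp
qed

theorem proposition3p6:
  fixes n :: nat
  assumes "n \<ge> 3"
  shows "sigma_index (caterpillar n 3) = 48 * (int n - 2) + 56"
  \<comment> \<open>For \<open>m = 3\<close>: 3 * 4^2 = 48 and 2 * 3^3 + 2 = 56.\<close>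
  using assms by (simp add: sigma_index_caterpillar)

end
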